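(* Let $A\in\mathbf{C}^{m\times n}$ have rank $r$ and singular values $\sigma_{1}(A)\geq\sigma_{2}(A)\geq\cdots\geq\sigma_{r}(A)>0$, and set $\sigma_{r+1}(A)=\cdots=\sigma_{\max\{m,n\}}(A)=0$. Let $A=U^{H}\Sigma V$ be a singular value decomposition of $A$, where $U=(u_{ij})_{1\le i,j\le m}$ is an $m\times m$ unitary matrix, $V=(v_{ls})_{1\le l,s\le n}$ is an $n\times n$ unitary matrix, and $\Sigma$ is the $m\times n$ matrix whose $(i,i)$ entry is $\sigma_i(A)$ for $1\le i\le\min\{m,n\}$ and whose other entries are $0$. For $1\le j\le m$ let $\bar{A}_j$ be the $(m-1)\times n$ matrix obtained by deleting the $j$-th row of $A$, with singular values $\sigma_k(\bar{A}_j)$, $1\le k\le m-1$. For $1\le s\le n$ let $\hat{A}_s$ be the $m\times(n-1)$ matrix obtained by deleting the $s$-th column of $A$, with singular values $\sigma_t(\hat{A}_s)$, $1\le t\le n-1$. (Lists of singular values are extended by zeros where necessary.) Then \[ |u_{ij}|^{2}\prod_{k=1,\,k\neq i}^{m}\left(\sigma_{i}^{2}(A)-\sigma_{k}^{2}(A)\right)=\prod_{k=1}^{m-1}\left(\sigma_{i}^{2}(A)-\sigma_{k}^{2}(\bar{A}_{j})\right),\qquad 1\leq i,j\leq m, \] and \[ |v_{ls}|^{2}\prod_{t=1,\,t\neq l}^{n}\left(\sigma_{l}^{2}(A)-\sigma_{t}^{2}(A)\right)=\prod_{t=1}^{n-1}\left(\sigma_{l}^{2}(A)-\sigma_{t}^{2}(\hat{A}_{s})\right),\qquad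 1\leq l,s\leq n. \]
   Context: $M^{H}$ denotes the conjugate transpose of a complex matrix $M$. The singular value decomposition is written in the form $A=U^{H}\Sigma V$ (not $U\Sigma V^{H}$), so $AA^{H}=U^{H}\Sigma\Sigma^{H}U$ and $A^{H}A=V^{H}\Sigma^{H}\Sigma V$; $u_{ij}$ and $v_{ls}$ are the $(i,j)$ entry of $U$ and the $(l,s)$ entry of $V$. Convention on singular values: a $p\times q$ matrix $M$ is assigned $\max\{p,q\}$ singular values, namely its usual $\min\{p,q\}$ singular values (listed with multiplicity) in nonincreasing order followed by zeros. Thus $\sigma_1^2(M),\ldots,\sigma_p^2(M)$ are the eigenvalues of $MM^{H}$ with multiplicity and $\sigma_1^2(M),\ldots,\sigma_q^2(M)$ are the eigenvalues of $M^{H}M$ with multiplicity. Empty products equal $1$. *)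

theory Defs
  imports
    Jordan_Normal_Form.Schur_Decomposition
    Jordan_Normal_Form.DL_Rank
    Jordan_Normal_Form.DL_Submatrix
    "HOL-Computational_Algebra.Fundamental_Theorem_Algebra"
begin

definition unitary_mat :: "nat \<Rightarrow> complex mat \<Rightarrow> bool" where
  "unitary_mat n U \<longleftrightarrow> U \<in> carrier_mat n n \<and>
     mat_adjoint U * U = 1\<^sub>m n \<and> U * mat_adjoint U = 1\<^sub>m n"

text \<open>
  The smaller of the two Gram matrices; for a p by q matrix it is square of size min p q.
\<close>

definition gram_mat :: "complex mat \<Rightarrow> complex mat" where
  "gram_mat M =
     (if dim_row M \<le> dim_col M then M * mat_adjoint M else mat_adjoint M * M)"

text \<open>
  The min p q usual singular values in nonincreasing order. The eigenvalues of the Gram matrix,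
  taken with algebraic multiplicity as the roots of its characteristic polynomial, are real and
  nonnegative because that matrix is Hermitian and positive semidefinite, so \<^const>\<open>Re\<close> is only
  a change of type.
\<close>

definition singular_values :: "complex mat \<Rightarrow> real list" where
  "singular_values M =
     rev (sorted_list_of_multiset
       (image_mset (\<lambda>z. sqrt (Re z)) (proots (char_poly (gram_mat M)))))"

text \<open>
  Like matrix entries, singular values are indexed from 0, so \<open>singular_value M k\<close> is the
  (k+1)-st largest one; the list is continued by zeros.
\<close>

definition singular_value :: "complex mat \<Rightarrow> nat \<Rightarrow> real" where
  "singular_value M k =
     (if k < length (singular_values M) then singular_values M ! k else 0)"

text \<open>
  The decomposition is taken in the form \<open>A = U\<^sup>H \<Sigma> V\<close>, with the adjoint on the left factor.
\<close>

definition is_svd :: "complex mat \<Rightarrow> complex mat \<Rightarrow> complex mat \<Rightarrow> complex mat \<Rightarrow> bool" where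
  "is_svd A U \<Sigma> V \<longleftrightarrow>
     unitary_mat (dim_row A) U \<and> unitary_mat (dim_col A) V \<and>
     \<Sigma> = mat (dim_row A) (dim_col A)
       (\<lambda>(i, j). if i = j then complex_of_real (singular_value A i) else 0) \<and>
     A = mat_adjoint U * \<Sigma> * V"

definition delete_row :: "'a mat \<Rightarrow> nat \<Rightarrow> 'a mat" where
  "delete_row A j = submatrix A (- {j}) UNIV"

definition delete_col :: "'a mat \<Rightarrow> nat \<Rightarrow> 'a mat" where
  "delete_col A s = submatrix A UNIV (- {s})"

lemma pick_all: "pick UNIV i = i"
proof (induction i)
  case (Suc i)
  then show ?case by (auto intro!: Least_equality)
qed (auto intro!: Least_equality)

lemma pick_minus_singleton: "pick (- {j}) i = (if i < j then i else Suc i)"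
proof (induction i)
  case 0
  then show ?case by (auto intro!: Least_equality)
next
  case (Suc i)
  then show ?case by (auto intro!: Least_equality)
qed

lemma card_index_minus: "j < (p::nat) \<Longrightarrow> card {i. i < p \<and> i \<in> - {j}} = p - 1"
proof -
  assume "j < p"
  moreover have "{i. i < p \<and> i \<in> - {j}} = {..<p} - {j}" by auto
  ultimately show ?thesis by (simp del: Compl_iff)
qed

lemma delete_row_eq:
  assumes "A \<in> carrier_mat m n" "j < m"
  shows "delete_row A j =
    mat (m - 1) n (\<lambda>(i, l). A $$ (if i < j then i else Suc i, l))"
  using assms card_index_minus[of j m]
  unfolding delete_row_def submatrix_def pick_all pick_minus_singleton by auto

lemma delete_col_eq:
  assumes "A \<in> carrier_mat m n" "s < n"
  shows "delete_col A s =
    mat m (n - 1) (\<lambda>(i, l). A $$ (i, if l < s then l else Suc l))"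
  using assms card_index_minus[of s n]
  unfolding delete_col_def submatrix_def pick_all pick_minus_singleton by auto

end

theory Submission
  imports Defs
begin

text \<open>
  Both formulas are instances of the eigenvector-eigenvalue identity for Hermitian matrices. The
  decomposition diagonalises the two Gram matrices: \<open>A A\<^sup>H = U\<^sup>H D U\<close> and
  \<open>A\<^sup>H A = V\<^sup>H D' V\<close>, where the diagonals consist of the squared singular values of \<open>A\<close>,
  continued by zeros (\<open>is_svd_grams\<close>). Deleting row \<open>j\<close> of \<open>A\<close> deletes row and column \<open>j\<close> of
  \<open>A A\<^sup>H\<close>, and deleting column \<open>s\<close> of \<open>A\<close> does the same to \<open>A\<^sup>H A\<close>, so the right-hand sides are
  characteristic polynomials of principal minors, evaluated at \<open>\<sigma>\<^sub>i\<^sup>2\<close>.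

  Such a characteristic polynomial is a diagonal entry of the adjugate of \<open>x I - H\<close>. For
  \<open>H = W\<^sup>H D W\<close> the adjugate is \<open>W\<^sup>H E W\<close>, where \<open>E\<close> is the adjugate of the diagonal matrix
  \<open>x I - D\<close>, with the entries \<open>\<Prod>\<^sub>k\<^sub>\<noteq>\<^sub>i (x - d\<^sub>k)\<close>. Hence the characteristic polynomial of the
  minor is \<open>\<Sum>\<^sub>i |w\<^sub>i\<^sub>j|\<^sup>2 \<Prod>\<^sub>k\<^sub>\<noteq>\<^sub>i (x - d\<^sub>k)\<close> (\<open>char_poly_mat_delete_conj_diagm\<close>), and at
  \<open>x = d\<^sub>i\<close> only the term with index \<open>i\<close> survives. Repeated singular values need no separate
  treatment, because the identity is one of polynomials.

  Singular values are defined from the smaller Gram matrix only. That the larger one has the same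
  eigenvalues and additional zeros (\<open>char_poly_both_grams\<close>) follows from the comparison of the
  characteristic polynomials of \<open>A B\<close> and \<open>B A\<close> (\<open>char_poly_mult_swap\<close>).
\<close>

section \<open>Adjoints\<close>

lemma mat_adjoint_carrier [simp]:
  "A \<in> carrier_mat m n \<Longrightarrow> mat_adjoint A \<in> carrier_mat n m"
  unfolding mat_adjoint_def by auto

lemma mat_adjoint_dim [simp]:
  "dim_row (mat_adjoint A) = dim_col A" "dim_col (mat_adjoint A) = dim_row A"
  unfolding mat_adjoint_def by auto

lemma mat_adjoint_index [simp]:
  "i < dim_col A \<Longrightarrow> j < dim_row A \<Longrightarrow> mat_adjoint A $$ (i, j) = conjugate (A $$ (j, i))"
  unfolding mat_adjoint_def by (simp add: mat_of_rows_index)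

lemma mat_adjoint_mat_adjoint [simp]:
  fixes A :: "complex mat"
  shows "mat_adjoint (mat_adjoint A) = A"
  by (rule eq_matI) auto

lemma mat_adjoint_mult:
  fixes A B :: "complex mat"
  assumes "A \<in> carrier_mat m n" "B \<in> carrier_mat n p"
  shows "mat_adjoint (A * B) = mat_adjoint B * mat_adjoint A"
  using assms by (intro eq_matI) (auto simp: scalar_prod_def mult.commute)

lemma mat_adjoint_mult_vec_cscalar_prod:
  fixes N :: "complex mat"
  assumes N: "N \<in> carrier_mat m n" and w: "w \<in> carrier_vec m" and v: "v \<in> carrier_vec n"
  shows "(mat_adjoint N *\<^sub>v w) \<bullet>c v = w \<bullet>c (N *\<^sub>v v)"
proof -
  have "(mat_adjoint N *\<^sub>v w) \<bullet>c v = (\<Sum>i<n. \<Sum>k<m. cnj (N $$ (k, i)) * w $ k * cnj (v $ i))"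
    using assms by (auto simp: scalar_prod_def sum_distrib_right atLeast0LessThan intro!: sum.cong)
  also have "\<dots> = (\<Sum>k<m. \<Sum>i<n. cnj (N $$ (k, i)) * w $ k * cnj (v $ i))"
    by (rule sum.swap)
  also have "\<dots> = w \<bullet>c (N *\<^sub>v v)"
    using assms
    by (auto simp: scalar_prod_def sum_distrib_left atLeast0LessThan ac_simps intro!: sum.cong)
  finally show ?thesis .
qed

text \<open>
  From \<open>N\<^sup>H N v = z v\<close> one gets \<open>z \<parallel>v\<parallel>\<^sup>2 = \<parallel>N v\<parallel>\<^sup>2\<close>. The order on the complex numbers makes
  \<open>z \<ge> 0\<close> include that \<open>z\<close> is real.
\<close>

lemma eigenvalue_adjoint_mult_self_nonneg:
  fixes N :: "complex mat"
  assumes N: "N \<in> carrier_mat m n" and z: "eigenvalue (mat_adjoint N * N) z"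
  shows "z \<ge> 0"
proof -
  obtain v where v: "v \<in> carrier_vec n" "v \<noteq> 0\<^sub>v n" "mat_adjoint N * N *\<^sub>v v = z \<cdot>\<^sub>v v"
    using z N unfolding eigenvalue_def eigenvector_def by auto
  have Nv: "N *\<^sub>v v \<in> carrier_vec m" using N v by auto
  have "z * (v \<bullet>c v) = (z \<cdot>\<^sub>v v) \<bullet>c v"
    using v by simp
  also have "z \<cdot>\<^sub>v v = mat_adjoint N *\<^sub>v (N *\<^sub>v v)"
    using v N by (metis assoc_mult_mat_vec mat_adjoint_carrier)
  also have "\<dots> \<bullet>c v = (N *\<^sub>v v) \<bullet>c (N *\<^sub>v v)"
    by (rule mat_adjoint_mult_vec_cscalar_prod[OF N Nv v(1)])
  finally have eq: "z * (v \<bullet>c v) = (N *\<^sub>v v) \<bullet>c (N *\<^sub>v v)" .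
  have pos: "v \<bullet>c v > 0" using v by simp
  have "z * (v \<bullet>c v) \<ge> 0" unfolding eq by (rule conjugate_square_ge_0_vec)
  with pos show ?thesis
    by (auto simp: less_eq_complex_def less_complex_def zero_le_mult_iff)
qed

section \<open>The characteristic polynomials of a product in both orders\<close>

lemma char_poly_four_block_upper_right_zero:
  fixes A :: "'a :: idom mat"
  assumes A: "A \<in> carrier_mat n n" and C: "C \<in> carrier_mat m n" and D: "D \<in> carrier_mat m m"
  shows "char_poly (four_block_mat A (0\<^sub>m n m) C D) = char_poly A * char_poly D"
proof -
  have "char_poly_matrix (four_block_mat A (0\<^sub>m n m) C D) =
      four_block_mat (char_poly_matrix A) (0\<^sub>m n m) (map_mat (\<lambda>a. [:- a:]) C) (char_poly_matrix D)"
    using assms by (intro eq_matI) (auto simp: char_poly_matrix_def)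
  then show ?thesis
    unfolding char_poly_def using assms
    by (simp add: det_four_block_mat_upper_right_zero[where n = n and m = m])
qed

definition diagm :: "nat \<Rightarrow> (nat \<Rightarrow> 'a :: zero) \<Rightarrow> 'a mat" where
  "diagm n d = mat n n (\<lambda>(i, j). if i = j then d i else 0)"

lemma diagm_carrier [simp]: "diagm n d \<in> carrier_mat n n"
  by (simp add: diagm_def)

lemma diagm_dim [simp]: "dim_row (diagm n d) = n" "dim_col (diagm n d) = n"
  by (simp_all add: diagm_def)

lemma diagm_index [simp]:
  "i < n \<Longrightarrow> j < n \<Longrightarrow> diagm n d $$ (i, j) = (if i = j then d i else 0)"
  by (simp add: diagm_def)

lemma char_poly_diagm:
  "char_poly (diagm n d) = (\<Prod>i<n. [:- d i, 1:])"
proof -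
  let ?D = "diagm n d"
  have "char_poly ?D = (\<Prod>a\<leftarrow>diag_mat ?D. [:- a, 1:])"
    by (rule char_poly_upper_triangular[of _ n]) auto
  also have "diag_mat ?D = map d [0..<n]"
    by (auto simp: diag_mat_def)
  finally show ?thesis
    by (simp add: o_def prod.distinct_set_conv_list[symmetric] atLeast0LessThan)
qed

lemma char_poly_zero_mat: "char_poly (0\<^sub>m n n :: 'a :: comm_ring_1 mat) = [:0, 1:] ^ n"
proof -
  have "0\<^sub>m n n = diagm n (\<lambda>_. 0 :: 'a)"
    by (intro eq_matI) auto
  then show ?thesis by (simp add: char_poly_diagm)
qed

text \<open>
  The block matrices with rows \<open>(AB, 0), (B, 0)\<close> and \<open>(0, 0), (B, BA)\<close> are similar by the
  unipotent matrix with rows \<open>(I, A), (0, I)\<close>. Both are block triangular, so their characteristic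
  polynomials are the two sides.
\<close>

lemma char_poly_mult_swap:
  fixes A B :: "'a :: idom mat"
  assumes A: "A \<in> carrier_mat m n" and B: "B \<in> carrier_mat n m"
  shows "char_poly (A * B) * [:0, 1:] ^ n = [:0, 1:] ^ m * char_poly (B * A)"
proof -
  let ?L = "four_block_mat (A * B) (0\<^sub>m m n) B (0\<^sub>m n n)"
  let ?R = "four_block_mat (0\<^sub>m m m) (0\<^sub>m m n) B (B * A)"
  let ?P = "four_block_mat (1\<^sub>m m) A (0\<^sub>m n m) (1\<^sub>m n)"
  let ?Q = "four_block_mat (1\<^sub>m m) (- A) (0\<^sub>m n m) (1\<^sub>m n)"
  have AB: "A * B \<in> carrier_mat m m" and BA: "B * A \<in> carrier_mat n n" using A B by auto
  have [simp]: "- (0\<^sub>m n n :: 'a mat) = 0\<^sub>m n n" by (intro eq_matI) auto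
  have PQ: "?P * ?Q = 1\<^sub>m (m + n)" "?Q * ?P = 1\<^sub>m (m + n)"
    using A by (auto simp: mult_four_block_mat[where ?nr1.0 = m and ?n1.0 = m and ?n2.0 = n
          and ?nr2.0 = n and ?nc1.0 = m and ?nc2.0 = n] uminus_l_inv_mat[of _ m n]
          minus_add_uminus_mat[symmetric])
  have LP: "?L * ?P = ?P * ?R"
    using A B AB BA
    by (auto simp: mult_four_block_mat[where ?nr1.0 = m and ?n1.0 = m and ?n2.0 = n
          and ?nr2.0 = n and ?nc1.0 = m and ?nc2.0 = n])
  have c: "?L \<in> carrier_mat (m + n) (m + n)" "?R \<in> carrier_mat (m + n) (m + n)"
    "?P \<in> carrier_mat (m + n) (m + n)" "?Q \<in> carrier_mat (m + n) (m + n)"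
    using A B by auto
  have "?L = ?L * (?P * ?Q)" by (simp only: PQ(1) right_mult_one_mat[OF c(1)])
  also have "\<dots> = ?P * ?R * ?Q" 
    by (simp only: assoc_mult_mat[OF c(1) c(3) c(4), symmetric] LP)
  finally have "?L = ?P * ?R * ?Q" .
  then have "similar_mat ?L ?R"
    by (rule similar_matI[rotated 3]) (use c PQ in blast)+
  then have "char_poly ?L = char_poly ?R" by (rule char_poly_similar)
  then show ?thesis
    using char_poly_four_block_upper_right_zero[OF AB B, of "0\<^sub>m n n"]
      char_poly_four_block_upper_right_zero[OF _ B BA, of "0\<^sub>m m m"]
    by (simp add: char_poly_zero_mat)
qed

section \<open>Singular values and the characteristic polynomials of both Gram matrices\<close>

lemma gram_mat_carrier:
  "M \<in> carrier_mat p q \<Longrightarrow> gram_mat M \<in> carrier_mat (min p q) (min p q)"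
  unfolding gram_mat_def by auto

lemma length_singular_values:
  assumes "M \<in> carrier_mat p q"
  shows "length (singular_values M) = min p q"
proof -
  have "length (singular_values M) = size (proots (char_poly (gram_mat M)))"
    unfolding singular_values_def by (metis length_rev mset_sorted_list_of_multiset size_image_mset size_mset)
  then show ?thesis
    using degree_monic_char_poly[OF gram_mat_carrier[OF assms]] by (simp add: size_proots_complex)
qed

lemma singular_value_eq_0:
  "M \<in> carrier_mat p q \<Longrightarrow> min p q \<le> k \<Longrightarrow> singular_value M k = 0"
  by (auto simp: singular_value_def length_singular_values)

lemma gram_mat_root_nonneg:
  assumes "poly (char_poly (gram_mat M)) z = 0"
  shows "z \<ge> 0"
proof -
  have ev: "eigenvalue (gram_mat M) z"
    using assms eigenvalue_root_char_poly[OF gram_mat_carrier[of M "dim_row M" "dim_col M"]] by auto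
  show ?thesis
  proof (cases "dim_row M \<le> dim_col M")
    case True
    then have "gram_mat M = mat_adjoint (mat_adjoint M) * mat_adjoint M"
      by (simp add: gram_mat_def)
    then show ?thesis
      using ev eigenvalue_adjoint_mult_self_nonneg[of "mat_adjoint M" "dim_col M" "dim_row M" z] by auto
  next
    case False
    then show ?thesis
      using ev eigenvalue_adjoint_mult_self_nonneg[of M "dim_row M" "dim_col M" z]
      by (simp add: gram_mat_def)
  qed
qed

text \<open>
  A list of singular values stores \<open>sqrt (Re z)\<close> for each root \<open>z\<close>. Since the roots are real and
  nonnegative, squaring recovers \<open>z\<close>, and the factorisation over the complex numbers can be
  rewritten in terms of the list.
\<close>

lemma char_poly_gram_mat:
  assumes M: "M \<in> carrier_mat p q"
  shows "char_poly (gram_mat M) = (\<Prod>k<min p q. [:- complex_of_real ((singular_value M k)\<^sup>2), 1:])"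
proof -
  let ?c = "char_poly (gram_mat M)" and ?s = "\<lambda>z. sqrt (Re z)"
  let ?lin = "\<lambda>s. [:- complex_of_real (s\<^sup>2), 1:]"
  have monic: "lead_coeff ?c = 1" 
    using degree_monic_char_poly[OF gram_mat_carrier[OF M]] by simp
  then have nz: "?c \<noteq> 0" by auto
  have "?c = (\<Prod>z\<in>#proots ?c. [:- z, 1:])"
    using complex_poly_decompose_multiset[of ?c] monic by simp
  also have "\<dots> = (\<Prod>z\<in>#proots ?c. ?lin (?s z))"
  proof (rule arg_cong[of _ _ prod_mset], rule image_mset_cong)
    fix z assume "z \<in># proots ?c"
    then have "z \<ge> 0" using nz gram_mat_root_nonneg by simp
    then show "[:- z, 1:] = ?lin (?s z)"
      by (simp add: less_eq_complex_def complex_eq_iff)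
  qed
  also have "\<dots> = (\<Prod>s\<in>#mset (singular_values M). ?lin s)"
    unfolding singular_values_def by (simp add: image_mset.compositionality o_def)
  also have "\<dots> = (\<Prod>s\<leftarrow>singular_values M. ?lin s)"
    by (subst prod_mset_prod_list[symmetric]) simp
  also have "\<dots> = (\<Prod>k<length (singular_values M). ?lin (singular_values M ! k))"
    by (simp add: prod.list_conv_set_nth atLeast0LessThan)
  also have "\<dots> = (\<Prod>k<min p q. ?lin (singular_value M k))"
    using length_singular_values[OF M] by (intro prod.cong) (auto simp: singular_value_def)
  finally show ?thesis .
qed

lemma prod_singular_value_extend:
  assumes M: "M \<in> carrier_mat p q" and N: "min p q \<le> N"
  shows "(\<Prod>k<N. [:- complex_of_real ((singular_value M k)\<^sup>2), 1:]) =
    char_poly (gram_mat M) * [:0, 1:] ^ (N - min p q)"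
proof -
  let ?f = "\<lambda>k. [:- complex_of_real ((singular_value M k)\<^sup>2), 1:]"
  have "{..<N} = {..<min p q} \<union> {min p q..<N}" using N by auto
  then have "prod ?f {..<N} = prod ?f {..<min p q} * prod ?f {min p q..<N}"
    by (metis finite_atLeastLessThan finite_lessThan ivl_disj_int_one(2) prod.union_disjoint)
  also have "prod ?f {min p q..<N} = (\<Prod>k\<in>{min p q..<N}. [:0, 1:])"
    using singular_value_eq_0[OF M] by (intro prod.cong) auto
  finally show ?thesis by (simp add: char_poly_gram_mat[OF M])
qed

lemma char_poly_both_grams:
  assumes M: "M \<in> carrier_mat p q"
  shows "char_poly (M * mat_adjoint M) = (\<Prod>k<p. [:- complex_of_real ((singular_value M k)\<^sup>2), 1:])"
    and "char_poly (mat_adjoint M * M) = (\<Prod>k<q. [:- complex_of_real ((singular_value M k)\<^sup>2), 1:])"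
proof -
  let ?l = "char_poly (M * mat_adjoint M)" and ?r = "char_poly (mat_adjoint M * M)"
  let ?X = "[:0, 1:] :: complex poly"
  have swap: "?l * ?X ^ q = ?X ^ p * ?r"
    by (rule char_poly_mult_swap[OF M mat_adjoint_carrier[OF M]])
  have pw: "?X ^ (a + b) = ?X ^ a * ?X ^ b" for a b by (rule power_add)
  have "?l = char_poly (gram_mat M) * ?X ^ (p - min p q) \<and>
        ?r = char_poly (gram_mat M) * ?X ^ (q - min p q)"
  proof (cases "p \<le> q")
    case True
    then have g: "gram_mat M = M * mat_adjoint M" using M by (simp add: gram_mat_def)
    have "?X ^ q = ?X ^ p * ?X ^ (q - p)" using True pw[of p "q - p"] by simp
    then have "?X ^ p * (?l * ?X ^ (q - p)) = ?X ^ p * ?r" using swap by (simp only: ac_simps)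
    then show ?thesis using g True by simp
  next
    case False
    then have g: "gram_mat M = mat_adjoint M * M" using M by (simp add: gram_mat_def)
    have "?X ^ p = ?X ^ q * ?X ^ (p - q)" using False pw[of q "p - q"] by simp
    then have "?X ^ q * ?l = ?X ^ q * (?r * ?X ^ (p - q))" using swap by (simp only: ac_simps)
    then show ?thesis using g False by simp
  qed
  then show "?l = (\<Prod>k<p. [:- complex_of_real ((singular_value M k)\<^sup>2), 1:])"
    "?r = (\<Prod>k<q. [:- complex_of_real ((singular_value M k)\<^sup>2), 1:])"
    using prod_singular_value_extend[OF M, of p] prod_singular_value_extend[OF M, of q] by auto
qed

section \<open>Principal minors of a unitarily diagonalised matrix\<close>

lemma mult_diagm_index:
  fixes P :: "'a :: semiring_0 mat"
  assumes "P \<in> carrier_mat m n" "i < m" "k < n"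
  shows "(P * diagm n d) $$ (i, k) = P $$ (i, k) * d k"
proof -
  have "(P * diagm n d) $$ (i, k) = (\<Sum>l<n. P $$ (i, l) * (if l = k then d l else 0))"
    using assms by (simp add: diagm_def scalar_prod_def atLeast0LessThan)
  also have "\<dots> = (\<Sum>l<n. if l = k then P $$ (i, l) * d l else 0)"
    by (intro sum.cong) auto
  finally show ?thesis using assms(3) by simp
qed

lemma diagm_mult:
  fixes d e :: "nat \<Rightarrow> 'a :: semiring_0"
  shows "diagm n d * diagm n e = diagm n (\<lambda>i. d i * e i)"
  by (intro eq_matI) (auto simp: mult_diagm_index[of _ n n] simp del: index_mult_mat(1))

lemma mult_diagm_mult_index:
  fixes P Q :: "'a :: semiring_0 mat"
  assumes "P \<in> carrier_mat n n" "Q \<in> carrier_mat n n" "i < n" "j < n"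
  shows "(P * diagm n d * Q) $$ (i, j) = (\<Sum>k<n. P $$ (i, k) * d k * Q $$ (k, j))"
proof -
  have entry: "(R * Q) $$ (i, j) = (\<Sum>k<n. R $$ (i, k) * Q $$ (k, j))"
    if "R \<in> carrier_mat n n" for R
    using that assms by (simp add: scalar_prod_def atLeast0LessThan)
  have "(P * diagm n d * Q) $$ (i, j) = (\<Sum>k<n. (P * diagm n d) $$ (i, k) * Q $$ (k, j))"
    by (rule entry) (use assms in auto)
  also have "\<dots> = (\<Sum>k<n. P $$ (i, k) * d k * Q $$ (k, j))"
    using assms by (intro sum.cong) (auto simp: mult_diagm_index[of P n n] simp del: index_mult_mat(1))
  finally show ?thesis .
qed

lemma char_poly_matrix_mat_delete:
  assumes "A \<in> carrier_mat n n" "j < n"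
  shows "char_poly_matrix (mat_delete A j j) = mat_delete (char_poly_matrix A) j j"
  using assms by (intro eq_matI) (auto simp: char_poly_matrix_def mat_delete_def)

text \<open>
  The matrix \<open>N\<close> below is the conjugated adjugate of a diagonal matrix. It satisfies the same
  equation \<open>C N = det C \<cdot> I\<close> as the adjugate of \<open>C = x I - H\<close>. Working over polynomials, where
  \<open>det C\<close> can be cancelled, shows that \<open>N\<close> is the adjugate; after evaluation at an eigenvalue
  \<open>det C\<close> would vanish and the cancellation would fail.
\<close>

lemma char_poly_mat_delete_conj_diagm:
  fixes P Q :: "'a :: field mat"
  assumes P: "P \<in> carrier_mat n n" and Q: "Q \<in> carrier_mat n n"
    and PQ: "P * Q = 1\<^sub>m n" and QP: "Q * P = 1\<^sub>m n"
    and j: "j < n"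
  shows "char_poly (mat_delete (P * diagm n d * Q) j j) =
    (\<Sum>i<n. smult (P $$ (j, i) * Q $$ (i, j)) (\<Prod>k\<in>{..<n} - {i}. [:- d k, 1:]))"
proof -
  define H where "H = P * diagm n d * Q"
  have H: "H \<in> carrier_mat n n"
    unfolding H_def by (rule mult_carrier_mat[OF mult_carrier_mat[OF P diagm_carrier] Q])
  define C where "C = char_poly_matrix H"
  have C: "C \<in> carrier_mat n n" using H by (simp add: C_def)
  define P' where "P' = map_mat (\<lambda>a. [:a:]) P"
  define Q' where "Q' = map_mat (\<lambda>a. [:a:]) Q"
  have P': "P' \<in> carrier_mat n n" and Q': "Q' \<in> carrier_mat n n"
    using P Q by (auto simp: P'_def Q'_def)
  have one: "map_mat (\<lambda>a. [:a:]) (1\<^sub>m n) = (1\<^sub>m n :: 'a poly mat)"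
    by (intro eq_matI) auto
  have PQ': "P' * Q' = 1\<^sub>m n" and QP': "Q' * P' = 1\<^sub>m n"
    unfolding P'_def Q'_def map_poly_mult(1)[OF P Q, symmetric] map_poly_mult(1)[OF Q P, symmetric]
    by (simp_all add: PQ QP one)
  define X where "X = diagm n (\<lambda>k. [:- d k, 1:])"
  define E where "E = diagm n (\<lambda>i. \<Prod>k\<in>{..<n} - {i}. [:- d k, 1:])"
  define N where "N = P' * E * Q'"
  define c where "c = (\<Prod>k<n. [:- d k, 1:])"
  have X: "X \<in> carrier_mat n n" and E: "E \<in> carrier_mat n n" by (auto simp: X_def E_def)
  have N: "N \<in> carrier_mat n n" using P' Q' E by (simp add: N_def)
  \<comment> \<open>The scalar part \<open>x I\<close> survives the conjugation because \<open>P Q = I\<close>.\<close>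
  have C_eq: "C = P' * X * Q'"
  proof (rule eq_matI)
    fix a b assume "a < dim_row (P' * X * Q')" "b < dim_col (P' * X * Q')"
    then have ab: "a < n" "b < n" using P' Q' by auto
    have PQab: "(\<Sum>k<n. P $$ (a, k) * Q $$ (k, b)) = (1\<^sub>m n :: 'a mat) $$ (a, b)"
      using P Q ab by (subst PQ[symmetric]) (auto simp: scalar_prod_def atLeast0LessThan)
    have "(P' * X * Q') $$ (a, b) = (\<Sum>k<n. [:P $$ (a, k):] * [:- d k, 1:] * [:Q $$ (k, b):])"
      unfolding X_def using ab P Q P' Q'
      by (subst mult_diagm_mult_index) (auto simp: P'_def Q'_def)
    also have "\<dots> = (\<Sum>k<n. [:- (P $$ (a, k) * d k * Q $$ (k, b)):] +
        [:0, 1:] * [:P $$ (a, k) * Q $$ (k, b):])"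
      by (intro sum.cong) (auto simp: algebra_simps)
    also have "\<dots> = [:- (\<Sum>k<n. P $$ (a, k) * d k * Q $$ (k, b)):] +
        [:0, 1:] * [:\<Sum>k<n. P $$ (a, k) * Q $$ (k, b):]"
      by (induction n) (auto simp: sum.distrib)
    also have "\<dots> = [:- (H $$ (a, b)):] + [:0, 1:] * [:(1\<^sub>m n :: 'a mat) $$ (a, b):]"
      unfolding PQab H_def mult_diagm_mult_index[OF P Q ab] ..
    also have "\<dots> = C $$ (a, b)"
      using ab H by (auto simp: C_def char_poly_matrix_def)
    finally show "C $$ (a, b) = (P' * X * Q') $$ (a, b)" by simp
  qed (use C P' Q' in auto)
  have XE: "X * E = c \<cdot>\<^sub>m 1\<^sub>m n"
  proof -
    have "[:- d i, 1:] * (\<Prod>k\<in>{..<n} - {i}. [:- d k, 1:]) = c" if "i < n" for i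
      unfolding c_def using that by (subst prod.remove[of "{..<n}" i]) auto
    then show ?thesis
      unfolding X_def E_def diagm_mult by (intro eq_matI) (auto simp del: mult_pCons_left)
  qed
  have "C * N = P' * X * (Q' * P') * E * Q'"
    unfolding C_eq N_def using P' Q' X E by (simp add: assoc_mult_mat[of _ n n _ n _ n])
  also have "\<dots> = P' * (X * E) * Q'"
    using P' Q' X E by (simp add: QP' assoc_mult_mat[of _ n n _ n _ n])
  also have "\<dots> = c \<cdot>\<^sub>m 1\<^sub>m n"
    unfolding XE mult_smult_distrib[OF P' one_carrier_mat] right_mult_one_mat[OF P']
      mult_smult_assoc_mat[OF P' Q'] PQ' ..
  finally have CN: "C * N = c \<cdot>\<^sub>m 1\<^sub>m n" .
  have "det C = char_poly H" by (simp add: C_def char_poly_def)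
  also have "\<dots> = char_poly (diagm n d)"
    by (rule char_poly_similar, rule similar_matI[of _ _ P Q n])
      (use P Q H PQ QP in \<open>auto simp: H_def\<close>)
  also have "\<dots> = c" unfolding c_def by (rule char_poly_diagm)
  finally have det: "det C = c" .
  have c0: "c \<noteq> 0" by (simp add: c_def)
  note adj = adj_mat[OF C]
  \<comment> \<open>Evaluating \<open>adj C \<cdot> C \<cdot> N\<close> in both ways compares \<open>N\<close> with the adjugate.\<close>
  have "c \<cdot>\<^sub>m N = adj_mat C * C * N" 
    unfolding adj(3) det mult_smult_assoc_mat[OF one_carrier_mat N] left_mult_one_mat[OF N] ..
  also have "\<dots> = adj_mat C * (C * N)" using adj(1) C N by (simp add: assoc_mult_mat[of _ n n _ n _ n])
  also have "\<dots> = c \<cdot>\<^sub>m adj_mat C"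
    unfolding CN mult_smult_distrib[OF adj(1) one_carrier_mat] right_mult_one_mat[OF adj(1)] ..
  finally have "c * N $$ (j, j) = c * adj_mat C $$ (j, j)"
    using j N adj(1) by (metis carrier_matD index_smult_mat(1))
  then have "N $$ (j, j) = adj_mat C $$ (j, j)" using c0 by simp
  also have "\<dots> = det (mat_delete C j j)"
    using C j by (simp add: adj_mat_def cofactor_def)
  also have "\<dots> = char_poly (mat_delete H j j)"
    unfolding C_def char_poly_def char_poly_matrix_mat_delete[OF H j] ..
  finally have "char_poly (mat_delete H j j) = N $$ (j, j)" ..
  also have "\<dots> = (\<Sum>i<n. [:P $$ (j, i):] * (\<Prod>k\<in>{..<n} - {i}. [:- d k, 1:]) * [:Q $$ (i, j):])"
    unfolding N_def E_def using j P Q P' Q'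
    by (subst mult_diagm_mult_index) (auto simp: P'_def Q'_def)
  finally show ?thesis unfolding H_def by (simp add: mult.commute)
qed

text \<open>
  At \<open>x = d\<^sub>i\<close>, each term with index \<open>l \<noteq> i\<close> in the formula for the minor contains the factor
  \<open>d\<^sub>i - d\<^sub>i\<close>.
\<close>

lemma eigenvector_eigenvalue_identity:
  fixes W :: "complex mat" and d :: "nat \<Rightarrow> complex"
  assumes W: "unitary_mat n W" and i: "i < n" and j: "j < n"
  shows "(cmod (W $$ (i, j)))\<^sup>2 * (\<Prod>k\<in>{..<n} - {i}. d i - d k) =
    poly (char_poly (mat_delete (mat_adjoint W * diagm n d * W) j j)) (d i)"
proof -
  have Wc: "W \<in> carrier_mat n n" using W by (simp add: unitary_mat_def)
  let ?g = "\<lambda>l. (cmod (W $$ (l, j)))\<^sup>2 * (\<Prod>k\<in>{..<n} - {l}. d i - d k)"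
  have "poly (char_poly (mat_delete (mat_adjoint W * diagm n d * W) j j)) (d i) =
      (\<Sum>l<n. cnj (W $$ (l, j)) * W $$ (l, j) * (\<Prod>k\<in>{..<n} - {l}. d i - d k))"
    using W Wc j
    by (subst char_poly_mat_delete_conj_diagm) (auto simp: unitary_mat_def poly_sum poly_prod)
  also have "\<dots> = (\<Sum>l<n. ?g l)"
    by (intro sum.cong refl) (simp only: complex_norm_square mult.commute)
  also have "\<dots> = ?g i + sum ?g ({..<n} - {i})"
    using i by (simp add: sum.remove)
  also have "sum ?g ({..<n} - {i}) = 0"
  proof (rule sum.neutral, rule ballI)
    fix l assume "l \<in> {..<n} - {i}"
    then have "(\<Prod>k\<in>{..<n} - {l}. d i - d k) = 0" using i by (intro prod_zero) auto
    then show "?g l = 0" by simp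
  qed
  finally show ?thesis by simp
qed

section \<open>Gram matrices of a singular value decomposition\<close>

lemma mat_delete_mult_adjoint:
  fixes A :: "complex mat"
  assumes A: "A \<in> carrier_mat m n" and j: "j < m"
  shows "mat_delete (A * mat_adjoint A) j j = delete_row A j * mat_adjoint (delete_row A j)"
  using assms unfolding delete_row_eq[OF A j]
  by (intro eq_matI) (auto simp: mat_delete_def scalar_prod_def)

lemma mat_delete_adjoint_mult:
  fixes A :: "complex mat"
  assumes A: "A \<in> carrier_mat m n" and s: "s < n"
  shows "mat_delete (mat_adjoint A * A) s s = mat_adjoint (delete_col A s) * delete_col A s"
  using assms unfolding delete_col_eq[OF A s]
  by (intro eq_matI) (auto simp: mat_delete_def scalar_prod_def)

lemma mult_cancel_inner:
  fixes P S V W T Q :: "'a :: semiring_1 mat"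
  assumes c: "P \<in> carrier_mat a b" "S \<in> carrier_mat b n" "V \<in> carrier_mat n n"
    "W \<in> carrier_mat n n" "T \<in> carrier_mat n b" "Q \<in> carrier_mat b a"
    and VW: "V * W = 1\<^sub>m n"
  shows "(P * S * V) * (W * (T * Q)) = P * (S * T) * Q"
proof -
  have PS: "P * S \<in> carrier_mat a n" and TQ: "T * Q \<in> carrier_mat n a"
    and ST: "S * T \<in> carrier_mat b b"
    using c by auto
  have "(P * S * V) * (W * (T * Q)) = P * S * (V * (W * (T * Q)))"
    by (rule assoc_mult_mat[OF PS c(3)]) (use c TQ in auto)
  also have "V * (W * (T * Q)) = T * Q"
    unfolding assoc_mult_mat[OF c(3,4) TQ, symmetric] VW by (rule left_mult_one_mat[OF TQ])
  also have "P * S * (T * Q) = P * (S * (T * Q))"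
    by (rule assoc_mult_mat[OF c(1,2) TQ])
  also have "S * (T * Q) = S * T * Q"
    by (rule assoc_mult_mat[OF c(2,5,6), symmetric])
  also have "P * (S * T * Q) = P * (S * T) * Q"
    by (rule assoc_mult_mat[OF c(1) ST c(6), symmetric])
  finally show ?thesis .
qed

text \<open>
  The entries of \<open>\<Sigma> \<Sigma>\<^sup>H\<close> and \<open>\<Sigma>\<^sup>H \<Sigma>\<close> beyond the smaller dimension of \<open>A\<close> are zero, which agrees
  with the continuation of the singular values by zeros. One diagonal formula therefore serves both
  sizes.
\<close>

lemma is_svd_grams:
  assumes A: "A \<in> carrier_mat m n" and svd: "is_svd A U \<Sigma> V"
  shows "A * mat_adjoint A =
      mat_adjoint U * diagm m (\<lambda>k. complex_of_real ((singular_value A k)\<^sup>2)) * U"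
    and "mat_adjoint A * A =
      mat_adjoint V * diagm n (\<lambda>k. complex_of_real ((singular_value A k)\<^sup>2)) * V"
proof -
  let ?D = "\<lambda>N. diagm N (\<lambda>k. complex_of_real ((singular_value A k)\<^sup>2))"
  have U: "U \<in> carrier_mat m m" "U * mat_adjoint U = 1\<^sub>m m"
    and V: "V \<in> carrier_mat n n" "V * mat_adjoint V = 1\<^sub>m n"
    and \<Sigma>_def: "\<Sigma> = mat m n (\<lambda>(i, j). if i = j then complex_of_real (singular_value A i) else 0)"
    and A_eq: "A = mat_adjoint U * \<Sigma> * V"
    using svd A by (auto simp: is_svd_def unitary_mat_def)
  have \<Sigma>: "\<Sigma> \<in> carrier_mat m n" by (simp add: \<Sigma>_def)
  note c = U(1) V(1) \<Sigma> mat_adjoint_carrier[OF U(1)] mat_adjoint_carrier[OF V(1)]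
    mat_adjoint_carrier[OF \<Sigma>]
  have tail: "singular_value A k = 0" if "min m n \<le> k" for k
    by (rule singular_value_eq_0[OF A that])
  let ?f = "\<lambda>i. complex_of_real (singular_value A i)"
  have S1: "\<Sigma> * mat_adjoint \<Sigma> = ?D m"
  proof (rule eq_matI)
    fix i j assume "i < dim_row (?D m)" "j < dim_col (?D m)"
    then have ij: "i < m" "j < m" by auto
    have "(\<Sigma> * mat_adjoint \<Sigma>) $$ (i, j) = (\<Sum>k<n. \<Sigma> $$ (i, k) * cnj (\<Sigma> $$ (j, k)))"
      using ij \<Sigma> by (simp add: scalar_prod_def atLeast0LessThan)
    also have "\<dots> = (\<Sum>k<n. if k = i then if i = j then ?f i * ?f i else 0 else 0)"
      using ij by (intro sum.cong) (auto simp: \<Sigma>_def)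
    also have "\<dots> = ?D m $$ (i, j)"
      using ij tail[of i] by (auto simp: power2_eq_square)
    finally show "(\<Sigma> * mat_adjoint \<Sigma>) $$ (i, j) = ?D m $$ (i, j)" .
  qed (use \<Sigma> in auto)
  have S2: "mat_adjoint \<Sigma> * \<Sigma> = ?D n"
  proof (rule eq_matI)
    fix i j assume "i < dim_row (?D n)" "j < dim_col (?D n)"
    then have ij: "i < n" "j < n" by auto
    have "(mat_adjoint \<Sigma> * \<Sigma>) $$ (i, j) = (\<Sum>k<m. cnj (\<Sigma> $$ (k, i)) * \<Sigma> $$ (k, j))"
      using ij \<Sigma> by (simp add: scalar_prod_def atLeast0LessThan)
    also have "\<dots> = (\<Sum>k<m. if k = i then if i = j then ?f i * ?f i else 0 else 0)"
      using ij by (intro sum.cong) (auto simp: \<Sigma>_def)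
    also have "\<dots> = ?D n $$ (i, j)"
      using ij tail[of i] by (auto simp: power2_eq_square)
    finally show "(mat_adjoint \<Sigma> * \<Sigma>) $$ (i, j) = ?D n $$ (i, j)" .
  qed (use \<Sigma> in auto)
  have A_eq': "A = mat_adjoint U * (\<Sigma> * V)"
    unfolding A_eq by (rule assoc_mult_mat[OF c(4) \<Sigma> V(1)])
  have adj: "mat_adjoint A = mat_adjoint V * (mat_adjoint \<Sigma> * U)"
    unfolding A_eq mat_adjoint_mult[OF mult_carrier_mat[OF c(4) \<Sigma>] V(1)]
      mat_adjoint_mult[OF c(4) \<Sigma>] by simp
  have adj': "mat_adjoint A = mat_adjoint V * mat_adjoint \<Sigma> * U"
    unfolding adj by (rule assoc_mult_mat[OF c(5) c(6) U(1), symmetric])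
  have "A * mat_adjoint A =
      (mat_adjoint U * \<Sigma> * V) * (mat_adjoint V * (mat_adjoint \<Sigma> * U))"
    by (subst adj, subst A_eq) (rule refl)
  also have "\<dots> = mat_adjoint U * ?D m * U"
    unfolding S1[symmetric] by (rule mult_cancel_inner[OF c(4) c(3) c(2) c(5) c(6) c(1) V(2)])
  finally show "A * mat_adjoint A = mat_adjoint U * ?D m * U" .
  have "mat_adjoint A * A =
      (mat_adjoint V * mat_adjoint \<Sigma> * U) * (mat_adjoint U * (\<Sigma> * V))"
    by (subst adj', subst A_eq') (rule refl)
  also have "\<dots> = mat_adjoint V * ?D n * V"
    unfolding S2[symmetric] by (rule mult_cancel_inner[OF c(5) c(6) c(1) c(4) c(3) c(2) U(2)])
  finally show "mat_adjoint A * A = mat_adjoint V * ?D n * V" .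
qed

text \<open>
  The form shared by both halves of the theorem: \<open>G\<close> is one of the two Gram matrices of \<open>A\<close>, and
  \<open>t\<close> lists the singular values left after the deletion.
\<close>

lemma singular_vector_identity:
  fixes W G :: "complex mat" and s t :: "nat \<Rightarrow> real"
  assumes W: "unitary_mat n W"
    and G: "G = mat_adjoint W * diagm n (\<lambda>k. complex_of_real ((s k)\<^sup>2)) * W"
    and minor: "char_poly (mat_delete G j j) = (\<Prod>k<n - 1. [:- complex_of_real ((t k)\<^sup>2), 1:])"
    and i: "i < n" and j: "j < n"
  shows "(cmod (W $$ (i, j)))\<^sup>2 * (\<Prod>k\<in>{..<n} - {i}. (s i)\<^sup>2 - (s k)\<^sup>2) =
    (\<Prod>k<n - 1. (s i)\<^sup>2 - (t k)\<^sup>2)" (is "?l = ?r")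
proof -
  have "complex_of_real ?l = complex_of_real ?r"
    using eigenvector_eigenvalue_identity[OF W i j, of "\<lambda>k. complex_of_real ((s k)\<^sup>2)"]
    unfolding G[symmetric] minor by (simp add: poly_prod)
  then show ?thesis by (simp only: of_real_eq_iff)
qed

theorem theorem2:
  fixes A U \<Sigma> V :: "complex mat" and m n r :: nat
  assumes "A \<in> carrier_mat m n"
    and "vec_space.rank m A = r"
    and "is_svd A U \<Sigma> V"
  shows "(\<forall>i<m. \<forall>j<m.
            (cmod (U $$ (i, j)))\<^sup>2 *
              (\<Prod>k\<in>{..<m} - {i}. (singular_value A i)\<^sup>2 - (singular_value A k)\<^sup>2) =
            (\<Prod>k<m - 1. (singular_value A i)\<^sup>2 - (singular_value (delete_row A j) k)\<^sup>2)) \<and>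
         (\<forall>l<n. \<forall>s<n.
            (cmod (V $$ (l, s)))\<^sup>2 *
              (\<Prod>t\<in>{..<n} - {l}. (singular_value A l)\<^sup>2 - (singular_value A t)\<^sup>2) =
            (\<Prod>t<n - 1. (singular_value A l)\<^sup>2 - (singular_value (delete_col A s) t)\<^sup>2))"
proof (intro conjI allI impI)
  note A = assms(1) and svd = assms(3)
  have U: "unitary_mat m U" and V: "unitary_mat n V"
    using A svd by (auto simp: is_svd_def)
  fix i j :: nat
  {
    assume i: "i < m" and j: "j < m"
    have B: "delete_row A j \<in> carrier_mat (m - 1) n" by (simp add: delete_row_eq[OF A j])
    show "(cmod (U $$ (i, j)))\<^sup>2 *
        (\<Prod>k\<in>{..<m} - {i}. (singular_value A i)\<^sup>2 - (singular_value A k)\<^sup>2) =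
      (\<Prod>k<m - 1. (singular_value A i)\<^sup>2 - (singular_value (delete_row A j) k)\<^sup>2)"
      using char_poly_both_grams(1)[OF B] mat_delete_mult_adjoint[OF A j]
      by (intro singular_vector_identity[OF U is_svd_grams(1)[OF A svd] _ i j]) simp
  next
    assume i: "i < n" and j: "j < n"
    have B: "delete_col A j \<in> carrier_mat m (n - 1)" by (simp add: delete_col_eq[OF A j])
    show "(cmod (V $$ (i, j)))\<^sup>2 *
        (\<Prod>k\<in>{..<n} - {i}. (singular_value A i)\<^sup>2 - (singular_value A k)\<^sup>2) =
      (\<Prod>k<n - 1. (singular_value A i)\<^sup>2 - (singular_value (delete_col A j) k)\<^sup>2)"
      using char_poly_both_grams(2)[OF B] mat_delete_adjoint_mult[OF A j]
      by (intro singular_vector_identity[OF V is_svd_grams(2)[OF A svd] _ i j]) simp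
  }
qed

end
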